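(* There exist an infinite set $\Omega$ and a binary relation $\mathcal{R} \subset \Omega \times \Omega$ such that: (1) $|\mathcal{R}| < |\operatorname{Sym}(\Omega)|$ and $|\mathcal{R}^c| < |\operatorname{Sym}(\Omega)|$; (2) $\operatorname{Aut}(\Omega, \mathcal{R}) = \{\mathrm{id}\}$.
   Context: $\operatorname{Sym}(\Omega)$ is the group of all permutations of $\Omega$, $\mathcal{R}^c = (\Omega \times \Omega) \setminus \mathcal{R}$ is the complement of $\mathcal{R}$, and $\operatorname{Aut}(\Omega, \mathcal{R}) := \{\sigma \in \operatorname{Sym}(\Omega) : u\mathcal{R}v \iff \sigma(u)\mathcal{R}\sigma(v) \text{ for all } u, v \in \Omega\}$. All arguments are in ZFC. *)

theory Defs
  imports "HOL-Combinatorics.Permutations"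
begin

unbundle cardinal_syntax

text \<open>
  Permutations of a set are functions on the whole type that act as the identity outside the set
  (library predicate \<open>permutes\<close>), so that each permutation of \<open>\<Omega>\<close> is represented exactly once and
  the identity of \<open>\<Omega>\<close> is represented by \<^const>\<open>id\<close>.
\<close>

definition Sym :: "'a set \<Rightarrow> ('a \<Rightarrow> 'a) set" where
  "Sym \<Omega> = {\<sigma>. \<sigma> permutes \<Omega>}"

definition rel_compl :: "'a set \<Rightarrow> ('a \<times> 'a) set \<Rightarrow> ('a \<times> 'a) set" where
  "rel_compl \<Omega> R = (\<Omega> \<times> \<Omega>) - R"

definition Aut :: "'a set \<Rightarrow> ('a \<times> 'a) set \<Rightarrow> ('a \<Rightarrow> 'a) set" where
  "Aut \<Omega> R = {\<sigma> \<in> Sym \<Omega>. \<forall>u\<in>\<Omega>. \<forall>v\<in>\<Omega>. (u, v) \<in> R \<longleftrightarrow> (\<sigma> u, \<sigma> v) \<in> R}"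

end

theory Submission
  imports Defs
begin

text \<open>
  Since \<open>\<Omega>\<close> is infinite, \<open>\<Omega> \<times> \<Omega>\<close> has only \<open>|\<Omega>|\<close> elements, whereas \<open>\<Omega>\<close> has at least as
  many permutations as subsets, hence more than \<open>|\<Omega>|\<close>. Therefore the two cardinality bounds hold
  for every relation on \<open>\<Omega>\<close>, and it remains to exhibit a rigid one. A well-order of \<open>\<Omega>\<close> is rigid,
  because an isomorphism between well-orders is unique. So every infinite set carries a relation
  as required.

  The lower bound on the number of permutations comes from splitting \<open>\<Omega>\<close> into two-element
  blocks indexed by \<open>\<Omega>\<close> itself: each subset of \<open>\<Omega>\<close> selects a set of blocks, and the permutation
  that swaps the two elements of exactly the selected blocks determines the subset.
\<close>

text \<open>
  The blocks exist because \<open>\<Omega> \<times> UNIV\<close>, with \<open>UNIV\<close> the two truth values, is equinumerous with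
  the infinite set \<open>\<Omega>\<close>: a bijection \<open>f\<close> carries the fibres \<open>{x} \<times> UNIV\<close> to the blocks.
\<close>

lemma Pow_ordLeq_Sym:
  assumes "infinite \<Omega>"
  shows "|Pow \<Omega>| \<le>o |Sym \<Omega>|"
proof -
  have "|UNIV :: bool set| \<le>o |\<Omega>|"
    using assms
    by (intro ordLess_imp_ordLeq finite_ordLess_infinite card_of_Well_order)
      (auto simp: Field_card_of)
  then have "|\<Omega> \<times> (UNIV :: bool set)| =o |\<Omega>|"
    using assms card_of_Times_infinite[of \<Omega> "UNIV :: bool set"] by auto
  then obtain f where f: "bij_betw f (\<Omega> \<times> (UNIV :: bool set)) \<Omega>"
    using card_of_ordIso by blast
  define g where "g = inv_into (\<Omega> \<times> (UNIV :: bool set)) f"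
  have gf: "g (f (x, b)) = (x, b)" if "x \<in> \<Omega>" for x b
    unfolding g_def using f that by (intro bij_betw_inv_into_left) auto
  have f_in: "f (x, b) \<in> \<Omega>" if "x \<in> \<Omega>" for x b
    using bij_betwE[OF f] that by auto
  have f_cases: "\<exists>x b. x \<in> \<Omega> \<and> y = f (x, b)" if "y \<in> \<Omega>" for y
    using bij_betw_imp_surj_on[OF f] that by blast
  \<comment> \<open>Inequality of truth values is exclusive or: the second coordinate is negated iff \<open>x \<in> A\<close>.\<close>
  define swap where
    "swap A y = (if y \<in> \<Omega> then f (fst (g y), snd (g y) \<noteq> (fst (g y) \<in> A)) else y)" for A y
  have swap_f: "swap A (f (x, b)) = f (x, b \<noteq> (x \<in> A))" if "x \<in> \<Omega>" for A x b
    using that by (simp add: swap_def gf f_in)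
  have involution: "swap A (swap A y) = y" for A y
  proof (cases "y \<in> \<Omega>")
    case True
    then obtain x b where "x \<in> \<Omega>" "y = f (x, b)" using f_cases by blast
    then show ?thesis by (cases "x \<in> A") (simp_all add: swap_f)
  qed (simp add: swap_def)
  have "swap A permutes \<Omega>" for A
    unfolding permutes_def using involution by (metis swap_def)
  then have "swap ` Pow \<Omega> \<subseteq> Sym \<Omega>"
    by (auto simp: Sym_def)
  moreover have "inj_on swap (Pow \<Omega>)"
  proof (rule inj_onI)
    fix A B assume AB: "A \<in> Pow \<Omega>" "B \<in> Pow \<Omega>" "swap A = swap B"
    have "x \<in> A \<longleftrightarrow> x \<in> B" if "x \<in> \<Omega>" for x
    proof -
      have "f (x, x \<in> A) = f (x, x \<in> B)"
        using swap_f[OF that, of A False] swap_f[OF that, of B False] AB(3) by simp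
      then show ?thesis using gf[OF that] by (metis prod.inject)
    qed
    with AB show "A = B" by blast
  qed
  ultimately show ?thesis using card_of_ordLeq by blast
qed

lemma subset_Times_ordLess_Sym:
  assumes "infinite \<Omega>" and "S \<subseteq> \<Omega> \<times> \<Omega>"
  shows "|S| <o |Sym \<Omega>|"
proof -
  have "|S| \<le>o |\<Omega> \<times> \<Omega>|" by (rule card_of_mono1) fact
  moreover have "|\<Omega> \<times> \<Omega>| =o |\<Omega>|" using assms(1) by (rule card_of_Times_same_infinite)
  ultimately have "|S| \<le>o |\<Omega>|" by (rule ordLeq_ordIso_trans)
  moreover have "|\<Omega>| <o |Pow \<Omega>|" by (rule card_of_Pow)
  ultimately have "|S| <o |Pow \<Omega>|" by (rule ordLeq_ordLess_trans)
  then show ?thesis using Pow_ordLeq_Sym[OF assms(1)] by (rule ordLess_ordLeq_trans)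
qed

text \<open>
  An automorphism of a well-order embeds it into itself, and so does the identity; two embeddings
  between the same well-orders coincide on the field, which here is all of \<open>\<Omega>\<close>.
\<close>

lemma Aut_well_order:
  assumes "well_order_on \<Omega> r"
  shows "Aut \<Omega> r = {id}"
proof (intro equalityI subsetI)
  have wo: "Well_order r" and field: "Field r = \<Omega>"
    using well_order_on_Well_order[OF assms] by auto
  fix \<sigma> assume "\<sigma> \<in> Aut \<Omega> r"
  then have perm: "\<sigma> permutes \<Omega>"
    and pres: "\<forall>u\<in>\<Omega>. \<forall>v\<in>\<Omega>. (u, v) \<in> r \<longleftrightarrow> (\<sigma> u, \<sigma> v) \<in> r"
    by (auto simp: Aut_def Sym_def)
  have "iso r r \<sigma>"
    using permutes_imp_bij[OF perm] pres by (simp add: iso_iff2 field)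
  moreover have "iso r r id" by (simp add: iso_iff2)
  ultimately have "\<sigma> x = id x" if "x \<in> \<Omega>" for x
    using embed_unique[OF wo wo, of \<sigma> id] that unfolding iso_def field by blast
  then have "\<sigma> = id"
    using permutes_not_in[OF perm] by fastforce
  then show "\<sigma> \<in> {id}" by simp
qed (simp add: Aut_def Sym_def permutes_id)

theorem theorem5p1:
  assumes "infinite (UNIV :: 'a set)"
  shows "\<exists>(\<Omega> :: 'a set) (R :: ('a \<times> 'a) set).
           infinite \<Omega> \<and> R \<subseteq> \<Omega> \<times> \<Omega> \<and>
           |R| <o |Sym \<Omega>| \<and> |rel_compl \<Omega> R| <o |Sym \<Omega>| \<and>
           Aut \<Omega> R = {id}"
proof -
  obtain r :: "('a \<times> 'a) set" where "well_order_on UNIV r"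
    using well_order_on by blast
  then have "Aut UNIV r = {id}" by (rule Aut_well_order)
  moreover have "|S| <o |Sym (UNIV :: 'a set)|" for S :: "('a \<times> 'a) set"
    using assms by (rule subset_Times_ordLess_Sym) simp
  ultimately have "infinite (UNIV :: 'a set) \<and> r \<subseteq> UNIV \<times> UNIV \<and>
      |r| <o |Sym (UNIV :: 'a set)| \<and> |rel_compl UNIV r| <o |Sym (UNIV :: 'a set)| \<and>
      Aut UNIV r = {id}"
    using assms by simp
  then show ?thesis by blast
qed

end
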